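(* Let $1\le m<n$, $T>0$, let $f:[0,T]\times\mathbb{R}^n\to\mathbb{R}^n$ be twice continuously differentiable, let $y_0\in\mathbb{R}^m$, $y_T\in\mathbb{R}^{n-m}$, and let $\mathcal{I}_T=\{j_1<j_2<\cdots<j_{n-m}\}\subset\{1,\ldots,n\}$. Let $c^k\in\mathbb{R}^{n-m}$ be such that the solution $x(t)=x(t;x_0(c^k))$ of $\dot{x}(t)=f(t,x(t))$, $x(0)=x_0(c^k)$, exists on $[0,T]$, and let $p^i$, $i\in\{1,\ldots,n\}$, be the adjoint functions along this $x$ with $p^i(T)=e_i$. Let $F$ be the shooting function, and assume that $F'(c^k)$ is invertible. Consider the linear system for $c^{k+1}\in\mathbb{R}^{n-m}$ $$\sum_{l=1}^{n-m}p^{j_r}_{m+l}(0)\,\bigl(c^{k+1}_l-c^k_l\bigr)=y_{T,r}-x_{j_r}(T;x_0(c^k)),\qquad r\in\{1,\ldots,n-m\}.$$ This system is the same as $$P_T\,\mathrm{P}(0)^{\mathrm{T}}\,(P_0^c)^{\mathrm{T}}\,(c^{k+1}-c^k)=-F(c^k),$$ and its solution is the Newton-Kantorovich iterate $$c^{k+1}=c^k-(F'(c^k))^{-1}F(c^k).$$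
   Context: The boundary value problem under consideration is $\dot{x}(t)=f(t,x(t))$, $t\in[0,T]$, with boundary conditions $x_i(0)=y_{0,i}$ for $i\in\{1,\ldots,m\}$ and $x_{j_r}(T)=y_{T,r}$ for $r\in\{1,\ldots,n-m\}$. For $c\in\mathbb{R}^{n-m}$ put $x_0(c)=\left[\begin{array}{c}y_0\\ c\end{array}\right]\in\mathbb{R}^n$, and let $x(t;x_0(c))$ be the solution of $\dot{x}=f(t,x)$ with initial value $x(0)=x_0(c)$. The matrix $P_T$ is the $(n-m)\times n$ matrix with $(P_T)_{r,s}=1$ if $s=j_r$ and $0$ otherwise; $P_0^c=[0_{n-m,m}\ \ I_{n-m}]$ is the $(n-m)\times n$ matrix selecting the last $n-m$ coordinates. The shooting function is $F(c)=P_T\,x(T;x_0(c))-y_T\in\mathbb{R}^{n-m}$ (defined for those $c$ for which the solution exists on $[0,T]$), and $F'(c)$ is its $(n-m)\times(n-m)$ Jacobian matrix. Write $f_x'(t,x)=\frac{\partial f(t,x)}{\partial x}$ and let $^{\mathrm{T}}$ denote the transpose. An adjoint function along a solution $x$ is a solution $p:[0,T]\to\mathbb{R}^n$ of $\dot{p}(t)=-f_x'(t,x(t))^{\mathrm{T}}p(t)$. For $i\in\{1,\ldots,n\}$, $p^i=(p^i_1,\ldots,p^i_n)^{\mathrm{T}}$ is the adjoint function with $p^i(T)=e_i$, the $i$-th canonical basis vector of $\mathbb{R}^n$, and $\mathrm{P}(t)=[p^1(t)\ \ldots\ p^n(t)]$ is the matrix with columns $p^i(t)$. *)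

theory Defs
  imports "HOL-Analysis.Analysis"
begin

text \<open>
  With \<open>m = CARD('m)\<close> and \<open>n - m = CARD('k)\<close>, the space $R^n$ is \<open>real ^ ('m + 'k)\<close>: the indices
  \<open>Inl _\<close> are the first \<open>m\<close> coordinates and \<open>Inr l\<close> is coordinate \<open>m + l\<close>.  Index types are
  nonempty, so \<open>1 \<le> m < n\<close> holds automatically.  The numbering of the coordinates is
  given by the linear orders on \<open>'m\<close> and \<open>'k\<close>, the first block preceding the last one.
\<close>

fun index_less :: "'m::linorder + 'k::linorder \<Rightarrow> 'm + 'k \<Rightarrow> bool" where
  "index_less (Inl a) (Inl b) \<longleftrightarrow> a < b"
| "index_less (Inl a) (Inr b) \<longleftrightarrow> True"
| "index_less (Inr a) (Inl b) \<longleftrightarrow> False"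
| "index_less (Inr a) (Inr b) \<longleftrightarrow> a < b"

text \<open>
  Derivatives are taken within \<open>S\<close>, i.e. one-sided at boundary points of \<open>S\<close>.  They are unique
  on the slab \<open>{0..T} \<times> UNIV\<close> with \<open>T > 0\<close>, where this notion is used.
\<close>

definition twice_continuously_differentiable_on ::
  "('a::real_normed_vector \<Rightarrow> 'b::real_normed_vector) \<Rightarrow> 'a set \<Rightarrow> bool" where
  "twice_continuously_differentiable_on g S \<longleftrightarrow>
     (\<exists>(g' :: 'a \<Rightarrow> 'a \<Rightarrow>\<^sub>L 'b) (g'' :: 'a \<Rightarrow> 'a \<Rightarrow>\<^sub>L 'a \<Rightarrow>\<^sub>L 'b).
        (\<forall>z\<in>S. (g has_derivative blinfun_apply (g' z)) (at z within S)) \<and>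
        (\<forall>z\<in>S. (g' has_derivative blinfun_apply (g'' z)) (at z within S)) \<and>
        continuous_on S g'')"

definition is_ivp_solution ::
  "(real \<Rightarrow> 'a \<Rightarrow> 'a) \<Rightarrow> real \<Rightarrow> 'a \<Rightarrow> (real \<Rightarrow> 'a::real_normed_vector) \<Rightarrow> bool" where
  "is_ivp_solution f T a x \<longleftrightarrow> x 0 = a \<and>
     (\<forall>t\<in>{0..T}. (x has_vector_derivative f t (x t)) (at t within {0..T}))"

text \<open>
  The value \<open>x(t; a)\<close>, for \<open>t \<in> {0..T}\<close>, of the solution on \<open>{0..T}\<close> with \<open>x(0) = a\<close>;
  unspecified if there is no solution on all of \<open>{0..T}\<close>.
\<close>

definition ivp_value ::
  "(real \<Rightarrow> 'a \<Rightarrow> 'a) \<Rightarrow> real \<Rightarrow> 'a::real_normed_vector \<Rightarrow> real \<Rightarrow> 'a" where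
  "ivp_value f T a t = (THE z. \<exists>x. is_ivp_solution f T a x \<and> z = x t)"

definition initial_value :: "real ^ 'm::finite \<Rightarrow> real ^ 'k::finite \<Rightarrow> real ^ ('m + 'k)" where
  "initial_value y0 c = (\<chi> i. case i of Inl a \<Rightarrow> y0 $ a | Inr l \<Rightarrow> c $ l)"

definition P_T :: "('k \<Rightarrow> 'm::finite + 'k::finite) \<Rightarrow> real ^ ('m + 'k) ^ 'k" where
  "P_T j = (\<chi> r s. if s = j r then 1 else 0)"

definition P_0c :: "real ^ ('m::finite + 'k::finite) ^ 'k" where
  "P_0c = (\<chi> r s. case s of Inl _ \<Rightarrow> 0 | Inr l \<Rightarrow> if l = r then 1 else 0)"

definition shooting ::
  "(real \<Rightarrow> real ^ ('m + 'k) \<Rightarrow> real ^ ('m + 'k)) \<Rightarrow> real \<Rightarrow> ('k \<Rightarrow> 'm + 'k) \<Rightarrow>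
   real ^ 'm::finite \<Rightarrow> real ^ 'k::finite \<Rightarrow> real ^ 'k \<Rightarrow> real ^ 'k" where
  "shooting f T j y0 yT c = P_T j *v ivp_value f T (initial_value y0 c) T - yT"

definition is_adjoint ::
  "(real \<Rightarrow> real ^ 'n \<Rightarrow> real ^ 'n) \<Rightarrow> real \<Rightarrow> (real \<Rightarrow> real ^ 'n) \<Rightarrow>
   (real \<Rightarrow> real ^ 'n::finite) \<Rightarrow> bool" where
  "is_adjoint f T x p \<longleftrightarrow>
     (\<forall>t\<in>{0..T}. (p has_vector_derivative - (transpose (jacobian (f t) (at (x t))) *v p t))
        (at t within {0..T}))"

definition adjoint_matrix :: "('n::finite \<Rightarrow> real \<Rightarrow> real ^ 'n) \<Rightarrow> real \<Rightarrow> real ^ 'n ^ 'n" where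
  "adjoint_matrix p t = (\<chi> s i. p i t $ s)"

end

theory Submission
  imports Defs
begin

text \<open>
  If \<open>w\<close> solves the equation with an initial value near \<open>x 0\<close>, then
  \<open>p\<^sup>i \<bullet> (w - x)\<close> is constant up to second order, because \<open>p\<^sup>i\<close> solves the adjoint equation.
  Comparing its values at \<open>T\<close>, where \<open>p\<^sup>i = e\<^sub>i\<close>, and at \<open>0\<close> shows that \<open>a \<mapsto> x\<^sub>i(T; a)\<close> has
  derivative \<open>h \<mapsto> p\<^sup>i(0) \<bullet> h\<close>.  Hence the matrix of the linear system is \<open>F'(c\<^sup>k)\<close>.
\<close>

section \<open>Gronwall estimate and global existence for Lipschitz fields\<close>

text \<open>Gronwall's inequality in differential form: by Cauchy-Schwarz, the squared norm weighted
  with \<open>exp (- (2 * L * s))\<close> has nonpositive derivative. Squaring avoids the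
  nondifferentiability of the norm at zero. Uniqueness and continuous dependence on initial values
  both rest on this estimate.\<close>

lemma norm_le_exp_of_derivative_bound:
  fixes z :: "real \<Rightarrow> 'a::real_inner"
  assumes z: "\<And>s. s \<in> {0..T} \<Longrightarrow> (z has_vector_derivative z' s) (at s within {0..T})"
    and bound: "\<And>s. s \<in> {0..T} \<Longrightarrow> norm (z' s) \<le> L * norm (z s)"
    and t: "t \<in> {0..T}"
  shows "norm (z t) \<le> norm (z 0) * exp (L * t)"
proof -
  define \<phi> where "\<phi> s = (z s \<bullet> z s) * exp (- (2 * L * s))" for s
  define \<phi>' where "\<phi>' s = (2 * (z s \<bullet> z' s) - 2 * L * (z s \<bullet> z s)) * exp (- (2 * L * s))" for s
  have "(\<phi> has_derivative (\<lambda>h. h * \<phi>' s)) (at s within {0..t})" if "0 \<le> s" "s \<le> t" for s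
  proof -
    have "(z has_derivative (\<lambda>h. h *\<^sub>R z' s)) (at s within {0..t})"
      using z[of s] t that
      by (auto simp: has_vector_derivative_def intro: has_derivative_subset)
    then show ?thesis
      unfolding \<phi>_def[abs_def] \<phi>'_def
      by (auto intro!: derivative_eq_intros simp: inner_commute algebra_simps)
  qed
  then obtain s where s: "s \<in> {0..t}" and eq: "\<phi> t - \<phi> 0 = (t - 0) * \<phi>' s"
    using mvt_very_simple[of 0 t \<phi> "\<lambda>s h. h * \<phi>' s"] t by auto
  have "z s \<bullet> z' s \<le> norm (z s) * norm (z' s)"
    by (rule norm_cauchy_schwarz)
  also have "\<dots> \<le> norm (z s) * (L * norm (z s))"
    using bound[of s] s t by (auto intro: mult_left_mono)
  also have "\<dots> = L * (z s \<bullet> z s)"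
    by (simp add: dot_square_norm power2_eq_square)
  finally have "\<phi>' s \<le> 0"
    unfolding \<phi>'_def by (auto intro!: mult_nonpos_nonneg)
  with eq t have "\<phi> t \<le> \<phi> 0"
    using mult_nonneg_nonpos[of t "\<phi>' s"] by simp
  then have "(norm (z t))\<^sup>2 * exp (- (2 * L * t)) \<le> (norm (z 0))\<^sup>2"
    by (simp add: \<phi>_def dot_square_norm)
  then have "(norm (z t))\<^sup>2 * exp (- (2 * L * t)) * exp (2 * L * t) \<le> (norm (z 0))\<^sup>2 * exp (2 * L * t)"
    by (rule mult_right_mono) simp
  moreover have "exp (- (2 * L * t)) * exp (2 * L * t) = 1" "exp (2 * L * t) = (exp (L * t))\<^sup>2"
    by (simp_all add: exp_minus power2_eq_square mult_exp_exp flip: exp_add)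
  ultimately have "(norm (z t))\<^sup>2 \<le> (norm (z 0) * exp (L * t))\<^sup>2"
    by (simp only: mult.assoc power_mult_distrib mult_1_right)
  then show ?thesis
    by (rule power2_le_imp_le) simp
qed

text \<open>
  The unknown of the fixed point equation is \<open>u t = exp (- 2 L t) w t\<close>: with this weight the
  Picard operator is a contraction on the whole interval, however long it is.
\<close>

lemma lipschitz_ivp_solution_exists:
  fixes g :: "real \<Rightarrow> 'a \<Rightarrow> 'a::euclidean_space"
  assumes T: "0 \<le> T" and L: "0 < L"
    and cont: "continuous_on ({0..T} \<times> UNIV) (\<lambda>(t, z). g t z)"
    and lip: "\<And>t z w. t \<in> {0..T} \<Longrightarrow> norm (g t z - g t w) \<le> L * norm (z - w)"
  shows "\<exists>w. is_ivp_solution g T a w"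
proof -
  \<comment> \<open>The weighted Picard operator has contraction factor \<open>L / K\<close>; this
    choice makes it 1/2.\<close>
  define K where "K = 2 * L"
  have K: "0 < K" using L by (simp add: K_def)
  define G where "G u s = g s (exp (K * s) *\<^sub>R apply_bcontfun u s)" for u :: "real \<Rightarrow>\<^sub>C 'a" and s
  define \<Psi> where "\<Psi> u t = exp (- (K * t)) *\<^sub>R (a + integral {0..t} (G u))" for u :: "real \<Rightarrow>\<^sub>C 'a" and t
  \<comment> \<open>The complete space at hand consists of bounded continuous functions on the whole
    real line. Composing with \<open>clip\<close> extends a function on \<open>{0..T}\<close> to
    such a function, constant beyond the endpoints.\<close>
  define clip where "clip t = max 0 (min T t)" for t
  have clip: "clip t \<in> {0..T}" for t using T by (auto simp: clip_def)
  have contclip: "continuous_on UNIV clip"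
    unfolding clip_def[abs_def] by (intro continuous_intros)
  have contG: "continuous_on {0..T} (G u)" for u
  proof -
    have "continuous_on {0..T} (\<lambda>s. (s, exp (K * s) *\<^sub>R apply_bcontfun u s))"
      by (intro continuous_intros) auto
    then have "continuous_on {0..T} (\<lambda>s. (\<lambda>(t, z). g t z) (s, exp (K * s) *\<^sub>R apply_bcontfun u s))"
      by (rule continuous_on_compose2[OF cont]) auto
    then show ?thesis by (simp add: G_def[abs_def])
  qed
  have intG: "((\<lambda>t. integral {0..t} (G u)) has_vector_derivative G u t) (at t within {0..T})"
    if "t \<in> {0..T}" for u t
    by (rule integral_has_vector_derivative[OF contG that])
  have cont\<Psi>: "continuous_on {0..T} (\<Psi> u)" for u
  proof -
    have "continuous_on {0..T} (\<lambda>t. integral {0..t} (G u))"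
      using intG by (meson continuous_on_vector_derivative)
    then show ?thesis unfolding \<Psi>_def by (intro continuous_intros)
  qed
  have bcf: "(\<lambda>t. \<Psi> u (clip t)) \<in> bcontfun" for u
  proof -
    have "continuous_on UNIV (\<lambda>t. \<Psi> u (clip t))"
      by (rule continuous_on_compose2[OF cont\<Psi> contclip]) (use clip in auto)
    moreover have "bounded (\<Psi> u ` {0..T})"
      by (intro compact_imp_bounded compact_continuous_image cont\<Psi>) simp
    then obtain B where "\<And>t. t \<in> {0..T} \<Longrightarrow> norm (\<Psi> u t) \<le> B"
      unfolding bounded_iff by blast
    ultimately show ?thesis
      using clip by (intro bcontfun_normI) auto
  qed
  define \<Phi> where "\<Phi> u = Bcontfun (\<lambda>t. \<Psi> u (clip t))" for u
  have \<Phi>: "apply_bcontfun (\<Phi> u) t = \<Psi> u (clip t)" for u t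
    using bcf[of u] by (simp add: \<Phi>_def Bcontfun_inverse)
  have "dist (\<Phi> u) (\<Phi> v) \<le> 1/2 * dist u v" for u v
  proof (rule dist_bound)
    fix t0 :: real
    define t where "t = clip t0"
    have t: "t \<in> {0..T}" unfolding t_def by (rule clip)
    have intble: "G u integrable_on {0..t}" for u
      using contG[of u] t by (intro integrable_continuous_real) (auto intro: continuous_on_subset)
    have E: "((\<lambda>s. L * dist u v * exp (K * s)) has_integral
               (dist u v / 2 * exp (K * t) - dist u v / 2 * exp (K * 0))) {0..t}"
      using t K
      by (intro fundamental_theorem_of_calculus)
         (auto intro!: derivative_eq_intros simp: K_def simp flip: has_real_derivative_iff_has_vector_derivative)
    have "norm (integral {0..t} (G u) - integral {0..t} (G v)) = norm (integral {0..t} (\<lambda>s. G u s - G v s))"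
      using intble by (simp add: integral_diff)
    also have "\<dots> \<le> integral {0..t} (\<lambda>s. L * dist u v * exp (K * s))"
    proof (rule integral_norm_bound_integral)
      fix s assume s: "s \<in> {0..t}"
      have "norm (G u s - G v s) \<le> L * norm (exp (K * s) *\<^sub>R (apply_bcontfun u s - apply_bcontfun v s))"
        using lip[of s] s t by (simp add: G_def algebra_simps)
      also have "\<dots> = L * exp (K * s) * dist (apply_bcontfun u s) (apply_bcontfun v s)"
        by (simp add: dist_norm)
      also have "\<dots> \<le> L * exp (K * s) * dist u v"
        using L by (intro mult_left_mono dist_bounded) auto
      finally show "norm (G u s - G v s) \<le> L * dist u v * exp (K * s)"
        by (simp add: algebra_simps)
    qed (use intble E in \<open>auto intro: integrable_diff\<close>)
    also have "\<dots> \<le> dist u v / 2 * exp (K * t)"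
      unfolding integral_unique[OF E] by simp
    finally have I: "norm (integral {0..t} (G u) - integral {0..t} (G v)) \<le> dist u v / 2 * exp (K * t)" .
    have "dist (\<Psi> u t) (\<Psi> v t) = exp (- (K * t)) * norm (integral {0..t} (G u) - integral {0..t} (G v))"
      by (simp add: \<Psi>_def dist_norm flip: scaleR_diff_right)
    also have "\<dots> \<le> exp (- (K * t)) * (dist u v / 2 * exp (K * t))"
      using I by (intro mult_left_mono) auto
    also have "\<dots> = 1/2 * dist u v"
      by (simp add: exp_minus)
    finally show "dist (apply_bcontfun (\<Phi> u) t0) (apply_bcontfun (\<Phi> v) t0) \<le> 1/2 * dist u v"
      by (simp add: \<Phi> t_def)
  qed
  then obtain u where u: "\<Phi> u = u"
    using banach_fix_type[of "1/2" \<Phi>] by auto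
  \<comment> \<open>Removing the weight from the fixed point turns \<open>G u t\<close> into
    \<open>g t (w t)\<close>, so \<open>w\<close> satisfies the integral form of the
    equation.\<close>
  define w where "w t = a + integral {0..t} (G u)" for t
  have u_eq: "apply_bcontfun u t = exp (- (K * t)) *\<^sub>R w t" if "t \<in> {0..T}" for t
  proof -
    have "clip t = t" using that by (simp add: clip_def)
    then show ?thesis using \<Phi>[of u t] u by (simp add: \<Psi>_def w_def)
  qed
  have "(w has_vector_derivative g t (w t)) (at t within {0..T})" if t: "t \<in> {0..T}" for t
  proof -
    have "G u t = g t (w t)"
      using u_eq[OF t] by (simp add: G_def exp_minus)
    then show ?thesis
      using intG[OF t, of u] unfolding w_def[abs_def]
      by (auto intro!: derivative_eq_intros)
  qed
  then have "is_ivp_solution g T a w"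
    by (simp add: is_ivp_solution_def w_def)
  then show ?thesis by blast
qed


section \<open>Solutions of a continuously differentiable field\<close>

locale continuously_differentiable_field =
  fixes f :: "real \<Rightarrow> 'a \<Rightarrow> 'a::euclidean_space"
    and Df :: "real \<Rightarrow> 'a \<Rightarrow> 'a \<Rightarrow>\<^sub>L 'a"
    and T :: real
  assumes T_nonneg: "0 \<le> T"
    and continuous: "continuous_on ({0..T} \<times> UNIV) (\<lambda>(t, z). f t z)"
    and derivative: "t \<in> {0..T} \<Longrightarrow> (f t has_derivative blinfun_apply (Df t z)) (at z)"
    and continuous_derivative: "continuous_on ({0..T} \<times> UNIV) (\<lambda>(t, z). Df t z)"
begin

text \<open>\<open>Df\<close> is bounded on the compact set
  \<open>{0..T} \<times> cball 0 R\<close>, and the ball is convex, so the mean value inequality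
  gives one Lipschitz constant for all times.\<close>

lemma lipschitz_on_cball:
  "\<exists>L>0. \<forall>t\<in>{0..T}. \<forall>z\<in>cball 0 R. \<forall>w\<in>cball 0 R. norm (f t z - f t w) \<le> L * norm (z - w)"
proof -
  have "bounded ((\<lambda>(t, z). Df t z) ` ({0..T} \<times> cball 0 R))"
    by (intro compact_imp_bounded compact_continuous_image compact_Times
          continuous_on_subset[OF continuous_derivative]) auto
  then obtain L where L: "0 < L" "\<And>t z. t \<in> {0..T} \<Longrightarrow> z \<in> cball 0 R \<Longrightarrow> norm (Df t z) \<le> L"
    unfolding bounded_pos by fastforce
  have "norm (f t z - f t w) \<le> L * norm (z - w)"
    if "t \<in> {0..T}" "z \<in> cball 0 R" "w \<in> cball 0 R" for t z w
    by (rule differentiable_bound[of "cball 0 R" "f t" "\<lambda>z. blinfun_apply (Df t z)"])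
       (use that L derivative in
         \<open>auto simp flip: norm_blinfun.rep_eq intro: has_derivative_at_withinI\<close>)
  with L(1) show ?thesis by blast
qed

lemma solution_continuous:
  assumes "is_ivp_solution f T a x"
  shows "continuous_on {0..T} x"
  by (rule continuous_on_vector_derivative[where f' = "\<lambda>t. f t (x t)"])
     (use assms in \<open>auto simp: is_ivp_solution_def\<close>)

lemma solution_bounded:
  assumes "is_ivp_solution f T a x"
  obtains R where "\<And>t. t \<in> {0..T} \<Longrightarrow> norm (x t) \<le> R"
proof -
  have "bounded (x ` {0..T})"
    by (intro compact_imp_bounded compact_continuous_image solution_continuous[OF assms]) simp
  then show ?thesis using that unfolding bounded_iff by blast
qed

text \<open>Two solutions stay in a common ball, where the field is Lipschitz. The Gronwall estimate
  then applies to their difference, which starts at zero.\<close>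

lemma solution_unique:
  assumes x: "is_ivp_solution f T a x" and w: "is_ivp_solution f T a w" and t: "t \<in> {0..T}"
  shows "w t = x t"
proof -
  obtain R1 where R1: "\<And>t. t \<in> {0..T} \<Longrightarrow> norm (x t) \<le> R1" by (rule solution_bounded[OF x]) blast
  obtain R2 where R2: "\<And>t. t \<in> {0..T} \<Longrightarrow> norm (w t) \<le> R2" by (rule solution_bounded[OF w]) blast
  obtain L where L: "\<And>t z w. t \<in> {0..T} \<Longrightarrow> z \<in> cball 0 (max R1 R2) \<Longrightarrow> w \<in> cball 0 (max R1 R2)
      \<Longrightarrow> norm (f t z - f t w) \<le> L * norm (z - w)"
    using lipschitz_on_cball[of "max R1 R2"] by blast
  have "norm (w t - x t) \<le> norm (w 0 - x 0) * exp (L * t)"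
  proof (rule norm_le_exp_of_derivative_bound[OF _ _ t])
    fix s assume s: "s \<in> {0..T}"
    show "((\<lambda>t. w t - x t) has_vector_derivative f s (w s) - f s (x s)) (at s within {0..T})"
      using x w s unfolding is_ivp_solution_def by (auto intro: has_vector_derivative_diff)
    show "norm (f s (w s) - f s (x s)) \<le> L * norm (w s - x s)"
      by (rule L[OF s]) (use R1[OF s] R2[OF s] in auto)
  qed
  then show ?thesis using x w by (simp add: is_ivp_solution_def)
qed

text \<open>Uniqueness makes the definite description in \<open>ivp_value\<close> well defined, so
  any known solution evaluates it.\<close>

lemma ivp_value_eq:
  assumes "is_ivp_solution f T a x" "t \<in> {0..T}"
  shows "ivp_value f T a t = x t"
  unfolding ivp_value_def using assms solution_unique by blast

text \<open>
  Precomposing the field with the projection onto a tube around \<open>x\<close> makes it globally Lipschitz;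
  solutions of the truncated equation that start close to \<open>x 0\<close> never leave the tube.
\<close>

lemma nearby_solutions:
  assumes x: "is_ivp_solution f T a0 x"
  obtains C \<delta> where "0 < C" "0 < \<delta>"
    "\<And>a. norm (a - a0) < \<delta> \<Longrightarrow>
      \<exists>w. is_ivp_solution f T a w \<and> (\<forall>t\<in>{0..T}. norm (w t - x t) \<le> C * norm (a - a0))"
proof -
  obtain R where R: "\<And>t. t \<in> {0..T} \<Longrightarrow> norm (x t) \<le> R" by (rule solution_bounded[OF x]) blast
  obtain L where L0: "0 < L" and L: "\<And>t z w. t \<in> {0..T} \<Longrightarrow> z \<in> cball 0 (R + 1) \<Longrightarrow> w \<in> cball 0 (R + 1)
      \<Longrightarrow> norm (f t z - f t w) \<le> L * norm (z - w)"
    using lipschitz_on_cball[of "R + 1"] by blast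
  \<comment> \<open>The tube has radius 1. Nearest-point projection onto a closed convex set is
    1-Lipschitz, so truncation keeps the constant \<open>L\<close>, and the tube lies in
    \<open>cball 0 (R + 1)\<close>.\<close>
  define \<pi> :: "'a \<Rightarrow> 'a" where "\<pi> = closest_point (cball 0 1)"
  have \<pi>_norm: "norm (\<pi> y) \<le> 1" for y
    using closest_point_in_set[of "cball 0 1" y] by (simp add: \<pi>_def)
  have \<pi>_lip: "norm (\<pi> y - \<pi> z) \<le> norm (y - z)" for y z
    using closest_point_lipschitz[of "cball 0 1" y z] by (simp add: \<pi>_def dist_norm)
  have \<pi>_id: "\<pi> y = y" if "norm y \<le> 1" for y
    using that by (simp add: \<pi>_def closest_point_self)
  define g where "g t z = f t (x t + \<pi> (z - x t))" for t z
  have tube: "x t + \<pi> y \<in> cball 0 (R + 1)" if "t \<in> {0..T}" for t y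
    using norm_triangle_ineq[of "x t" "\<pi> y"] R[OF that] \<pi>_norm[of y] by simp
  have lip: "norm (g t z - g t w) \<le> L * norm (z - w)" if t: "t \<in> {0..T}" for t z w
  proof -
    have "norm (g t z - g t w) \<le> L * norm (\<pi> (z - x t) - \<pi> (w - x t))"
      using L[OF t tube[OF t] tube[OF t], of "z - x t" "w - x t"] by (simp add: g_def)
    also have "\<dots> \<le> L * norm (z - w)"
      using \<pi>_lip[of "z - x t" "w - x t"] L0 by (intro mult_left_mono) auto
    finally show ?thesis .
  qed
  have cont: "continuous_on ({0..T} \<times> UNIV) (\<lambda>(t, z). g t z)"
  proof -
    have cx: "continuous_on ({0..T} \<times> (UNIV :: 'a set)) (\<lambda>q. x (fst q))"
      by (rule continuous_on_compose2[OF solution_continuous[OF x]]) (auto intro: continuous_intros)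
    have "continuous_on UNIV \<pi>"
      unfolding \<pi>_def by (rule continuous_on_closest_point) auto
    then have c\<pi>: "continuous_on ({0..T} \<times> UNIV) (\<lambda>q. \<pi> (snd q - x (fst q)))"
      by (rule continuous_on_compose2) (auto intro!: continuous_intros cx)
    have "continuous_on ({0..T} \<times> UNIV) (\<lambda>q. (fst q, x (fst q) + \<pi> (snd q - x (fst q))))"
      by (intro continuous_intros cx c\<pi>)
    then have "continuous_on ({0..T} \<times> UNIV)
        (\<lambda>q. (\<lambda>(t, z). f t z) (fst q, x (fst q) + \<pi> (snd q - x (fst q))))"
      by (rule continuous_on_compose2[OF continuous]) auto
    then show ?thesis by (simp add: g_def case_prod_unfold)
  qed
  \<comment> \<open>\<open>C\<close> is the largest Gronwall factor on \<open>{0..T}\<close>. An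
    initial deviation below \<open>1 / C\<close> therefore stays below 1, inside the tube where
    \<open>g\<close> and \<open>f\<close> agree.\<close>
  define C where "C = exp (L * T)"
  show ?thesis
  proof (rule that[of C "1 / C"])
    fix a assume a: "norm (a - a0) < 1 / C"
    obtain w where w: "is_ivp_solution g T a w"
      using lipschitz_ivp_solution_exists[OF T_nonneg L0 cont lip] by blast
    have bound: "norm (w t - x t) \<le> C * norm (a - a0)" if t: "t \<in> {0..T}" for t
    proof -
      have "norm (w t - x t) \<le> norm (w 0 - x 0) * exp (L * t)"
      proof (rule norm_le_exp_of_derivative_bound[OF _ _ t])
        fix s assume s: "s \<in> {0..T}"
        \<comment> \<open>The truncation does nothing on the centre of the tube, so \<open>x\<close>
          solves the truncated equation too and can be compared with \<open>w\<close>.\<close>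
        have "g s (x s) = f s (x s)" by (simp add: g_def \<pi>_id)
        then show "((\<lambda>t. w t - x t) has_vector_derivative g s (w s) - g s (x s)) (at s within {0..T})"
          using x w s unfolding is_ivp_solution_def by (auto intro: has_vector_derivative_diff)
        show "norm (g s (w s) - g s (x s)) \<le> L * norm (w s - x s)"
          by (rule lip[OF s])
      qed
      also have "\<dots> \<le> norm (w 0 - x 0) * C"
        unfolding C_def using t L0 by (intro mult_left_mono) auto
      finally show ?thesis using x w by (simp add: is_ivp_solution_def mult.commute)
    qed
    have "g t (w t) = f t (w t)" if t: "t \<in> {0..T}" for t
    proof -
      have "C * norm (a - a0) < 1" using a by (simp add: C_def field_simps)
      then show ?thesis using bound[OF t] by (simp add: g_def \<pi>_id)
    qed
    then have "is_ivp_solution f T a w"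
      using w by (simp add: is_ivp_solution_def)
    then show "\<exists>w. is_ivp_solution f T a w \<and> (\<forall>t\<in>{0..T}. norm (w t - x t) \<le> C * norm (a - a0))"
      using bound by blast
  qed (simp_all add: C_def)
qed

text \<open>Uniform continuity of \<open>Df\<close> on a compact neighbourhood of the trajectory
  keeps \<open>Df t z\<close> within \<open>e\<close> of \<open>Df t (x t)\<close> near
  \<open>x t\<close>. The mean value inequality then bounds the linearization error with a single
  radius for all times.\<close>

lemma uniform_linearization:
  assumes x: "is_ivp_solution f T a x" and e: "0 < e"
  obtains \<delta> where "0 < \<delta>"
    "\<And>t y. t \<in> {0..T} \<Longrightarrow> norm y < \<delta> \<Longrightarrow>
      norm (f t (x t + y) - f t (x t) - Df t (x t) y) \<le> e * norm y"
proof -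
  obtain R where R: "\<And>t. t \<in> {0..T} \<Longrightarrow> norm (x t) \<le> R" by (rule solution_bounded[OF x]) blast
  have "uniformly_continuous_on ({0..T} \<times> cball 0 (R + 1)) (\<lambda>(t, z). Df t z)"
    by (intro compact_uniformly_continuous compact_Times
          continuous_on_subset[OF continuous_derivative]) auto
  then obtain d where d: "0 < d"
    and uc: "\<And>t z w. t \<in> {0..T} \<Longrightarrow> z \<in> cball 0 (R + 1) \<Longrightarrow> w \<in> cball 0 (R + 1) \<Longrightarrow>
      dist z w < d \<Longrightarrow> norm (Df t z - Df t w) < e"
    using e unfolding uniformly_continuous_on_def
    by (fastforce simp: dist_Pair_Pair dist_norm)
  show ?thesis
  \<comment> \<open>The bound 1 keeps \<open>x t + y\<close> in \<open>cball 0 (R + 1)\<close>; the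
    bound \<open>d\<close> is the modulus of uniform continuity.\<close>
  proof (rule that[of "min d 1"])
    fix t and y :: 'a assume t: "t \<in> {0..T}" and y: "norm y < min d 1"
    have "norm (f t (x t + y) - f t (x t) - Df t (x t) ((x t + y) - x t)) \<le> norm ((x t + y) - x t) * e"
    proof (rule differentiable_bound_linearization[where S = "cball (x t) (norm y)"
            and f' = "\<lambda>z. blinfun_apply (Df t z)" and ?x0.0 = "x t"])
      fix z assume z: "z \<in> cball (x t) (norm y)"
      show "(f t has_derivative blinfun_apply (Df t z)) (at z within cball (x t) (norm y))"
        using derivative[OF t] by (rule has_derivative_at_withinI)
      have "norm z \<le> R + 1"
        using norm_triangle_ineq2[of z "x t"] z R[OF t] y by (simp add: dist_norm norm_minus_commute)
      then have "norm (Df t z - Df t (x t)) < e"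
        using z y R[OF t] by (intro uc[OF t]) (auto simp: dist_commute)
      then show "onorm (blinfun_apply (Df t z) - blinfun_apply (Df t (x t))) \<le> e"
        by (simp add: norm_blinfun.rep_eq minus_blinfun.rep_eq fun_diff_def)
    qed (auto simp: dist_norm mult_left_le_one_le)
    then show "norm (f t (x t + y) - f t (x t) - Df t (x t) y) \<le> e * norm y"
      by (simp add: mult.commute)
  qed (use d in auto)
qed

text \<open>
  Along an adjoint function \<open>p\<close> the derivative of \<open>p \<bullet> (w - x)\<close> is \<open>p\<close> applied to the linearization
  error of \<open>f\<close>, so \<open>p \<bullet> (w - x)\<close> is conserved up to \<open>o (norm (w 0 - x 0))\<close>.  This replaces the
  variational equation.
\<close>

lemma ivp_value_inner_adjoint_has_derivative:
  assumes x: "is_ivp_solution f T a0 x"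
    and p: "\<And>t. t \<in> {0..T} \<Longrightarrow> (p has_vector_derivative - q t) (at t within {0..T})"
    and q: "\<And>t v. t \<in> {0..T} \<Longrightarrow> q t \<bullet> v = p t \<bullet> Df t (x t) v"
  shows "((\<lambda>a. p T \<bullet> ivp_value f T a T) has_derivative (\<lambda>h. p 0 \<bullet> h)) (at a0)"
  unfolding has_derivative_at_alt
proof (intro conjI allI impI)
  fix e :: real assume e: "0 < e"
  obtain C \<delta> where C: "0 < C" and \<delta>: "0 < \<delta>" and near: "\<And>a. norm (a - a0) < \<delta> \<Longrightarrow>
      \<exists>w. is_ivp_solution f T a w \<and> (\<forall>t\<in>{0..T}. norm (w t - x t) \<le> C * norm (a - a0))"
    using nearby_solutions[OF x] by blast
  have "continuous_on {0..T} p" using p by (meson continuous_on_vector_derivative)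
  then have "bounded (p ` {0..T})" by (intro compact_imp_bounded compact_continuous_image) simp_all
  then obtain B where B: "0 < B" "\<And>t. t \<in> {0..T} \<Longrightarrow> norm (p t) \<le> B"
    unfolding bounded_pos by blast
  \<comment> \<open>The final error is at most \<open>T * B * e' * C * norm (a - a0)\<close>. Using
    \<open>T + 1\<close> instead of \<open>T\<close> keeps the denominator positive when
    \<open>T = 0\<close>.\<close>
  define e' where "e' = e / (B * C * (T + 1))"
  have e': "0 < e'" using e B C T_nonneg by (simp add: e'_def)
  have e'_eq: "(T + 1) * B * C * e' = e" using B C T_nonneg by (simp add: e'_def add_eq_0_iff_both_eq_0)
  obtain \<eta> where \<eta>: "0 < \<eta>" and lin: "\<And>t y. t \<in> {0..T} \<Longrightarrow> norm y < \<eta> \<Longrightarrow>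
      norm (f t (x t + y) - f t (x t) - Df t (x t) y) \<le> e' * norm y"
    using uniform_linearization[OF x e'] by blast
  have "norm (p T \<bullet> ivp_value f T a T - p T \<bullet> ivp_value f T a0 T - p 0 \<bullet> (a - a0)) \<le> e * norm (a - a0)"
    \<comment> \<open>Below \<open>\<delta>\<close> the perturbed solution exists on all of
      \<open>{0..T}\<close>; below \<open>\<eta> / C\<close> its deviation from \<open>x\<close>
      stays in the range of the linearization bound.\<close>
    if a: "norm (a - a0) < min \<delta> (\<eta> / C)" for a
  proof -
    obtain w where w: "is_ivp_solution f T a w"
      and wx: "\<And>t. t \<in> {0..T} \<Longrightarrow> norm (w t - x t) \<le> C * norm (a - a0)"
      using near[of a] a by auto
    define r where "r t = f t (w t) - f t (x t) - Df t (x t) (w t - x t)" for t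
    have small: "C * norm (a - a0) < \<eta>" using a C by (simp add: field_simps)
    have r: "norm (r t) \<le> e' * (C * norm (a - a0))" if t: "t \<in> {0..T}" for t
    proof -
      have "norm (r t) \<le> e' * norm (w t - x t)"
        using lin[OF t, of "w t - x t"] wx[OF t] small by (simp add: r_def)
      also have "\<dots> \<le> e' * (C * norm (a - a0))"
        using wx[OF t] e' by (intro mult_left_mono) auto
      finally show ?thesis .
    qed
    have "((\<lambda>t. p t \<bullet> (w t - x t)) has_derivative (\<lambda>h. h * (p t \<bullet> r t))) (at t within {0..T})"
      if "0 \<le> t" "t \<le> T" for t
    proof -
      have t: "t \<in> {0..T}" using that by simp
      have "(p has_derivative (\<lambda>h. h *\<^sub>R - q t)) (at t within {0..T})"
        "(w has_derivative (\<lambda>h. h *\<^sub>R f t (w t))) (at t within {0..T})"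
        "(x has_derivative (\<lambda>h. h *\<^sub>R f t (x t))) (at t within {0..T})"
        using p[OF t] x w t by (auto simp: is_ivp_solution_def has_vector_derivative_def)
      then show ?thesis
        by (auto intro!: derivative_eq_intros simp: q[OF t] r_def blinfun.diff_right inner_diff_right algebra_simps)
    qed
    from mvt_very_simple[OF T_nonneg this] obtain s where s: "s \<in> {0..T}"
      and "p T \<bullet> (w T - x T) - p 0 \<bullet> (w 0 - x 0) = (T - 0) * (p s \<bullet> r s)"
      by blast
    then have "norm (p T \<bullet> ivp_value f T a T - p T \<bullet> ivp_value f T a0 T - p 0 \<bullet> (a - a0))
        = T * norm (p s \<bullet> r s)"
      using ivp_value_eq[OF x, of T] ivp_value_eq[OF w, of T] x w T_nonneg
      by (simp add: is_ivp_solution_def inner_diff_right abs_mult)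
    also have "\<dots> \<le> T * (norm (p s) * norm (r s))"
      using T_nonneg by (intro mult_left_mono) (auto intro: Cauchy_Schwarz_ineq2)
    also have "\<dots> \<le> (T + 1) * (B * (e' * (C * norm (a - a0))))"
      using T_nonneg B(1) B(2)[OF s] r[OF s] by (intro mult_mono) auto
    also have "\<dots> = e * norm (a - a0)"
      unfolding e'_eq[symmetric] by (simp only: ac_simps)
    finally show ?thesis .
  qed
  then show "\<exists>d>0. \<forall>a. norm (a - a0) < d \<longrightarrow>
      norm (p T \<bullet> ivp_value f T a T - p T \<bullet> ivp_value f T a0 T - p 0 \<bullet> (a - a0)) \<le> e * norm (a - a0)"
    using \<delta> \<eta> C by (intro exI[of _ "min \<delta> (\<eta> / C)"]) auto
qed (rule bounded_linear_inner_right)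

end


section \<open>Spatial derivative of a field that is smooth on the slab\<close>

text \<open>Derivatives within the slab are one-sided in time at its ends, but each slice of fixed
  time is a whole copy of the space inside the slab. Composing with \<open>Pair t\<close> thus
  yields a full derivative in \<open>z\<close>, namely \<open>g'\<close> applied to
  \<open>(0, h)\<close>. It is continuous because \<open>g'\<close> is differentiable.\<close>

lemma twice_continuously_differentiable_imp_field:
  fixes f :: "real \<Rightarrow> 'a \<Rightarrow> 'a::euclidean_space"
  assumes T: "0 \<le> T"
    and C2: "twice_continuously_differentiable_on (\<lambda>(t, z). f t z) ({0..T} \<times> UNIV)"
  obtains Df where "continuously_differentiable_field f Df T"
proof -
  let ?S = "{0..T} \<times> (UNIV :: 'a set)"
  obtain g' :: "real \<times> 'a \<Rightarrow> (real \<times> 'a) \<Rightarrow>\<^sub>L 'a"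
      and g'' :: "real \<times> 'a \<Rightarrow> (real \<times> 'a) \<Rightarrow>\<^sub>L (real \<times> 'a) \<Rightarrow>\<^sub>L 'a"
    where g': "\<And>q. q \<in> ?S \<Longrightarrow> ((\<lambda>(t, z). f t z) has_derivative blinfun_apply (g' q)) (at q within ?S)"
      and g'': "\<And>q. q \<in> ?S \<Longrightarrow> (g' has_derivative blinfun_apply (g'' q)) (at q within ?S)"
    using C2 unfolding twice_continuously_differentiable_on_def by blast
  define Df where "Df t z = g' (t, z) o\<^sub>L Blinfun (Pair 0)" for t z
  have bl: "bounded_linear (Pair (0::real) :: 'a \<Rightarrow> real \<times> 'a)"
    by (intro bounded_linear_Pair bounded_linear_zero bounded_linear_ident)
  have "continuously_differentiable_field f Df T"
  proof
    show "0 \<le> T" by (rule T)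
    show "continuous_on ?S (\<lambda>(t, z). f t z)"
      using g' by (rule has_derivative_continuous_on)
    have "continuous_on ?S g'"
      using g'' by (rule has_derivative_continuous_on)
    then have "continuous_on ?S (\<lambda>q. g' q o\<^sub>L Blinfun (Pair 0))"
      by (intro bounded_bilinear.continuous_on[OF bounded_bilinear_blinfun_compose] continuous_on_const)
    then show "continuous_on ?S (\<lambda>(t, z). Df t z)"
      by (simp add: Df_def case_prod_unfold)
    fix t and z :: 'a assume t: "t \<in> {0..T}"
    have "((\<lambda>z. (t, z)) has_derivative Pair 0) (at z)"
      by (intro has_derivative_Pair has_derivative_const has_derivative_ident)
    moreover have "((\<lambda>(t, z). f t z) has_derivative blinfun_apply (g' (t, z))) (at (t, z) within range (Pair t))"
      by (rule has_derivative_subset[OF g']) (use t in auto)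
    ultimately have "((\<lambda>z. (\<lambda>(t, z). f t z) (t, z)) has_derivative (\<lambda>h. g' (t, z) (0, h))) (at z)"
      by (rule has_derivative_in_compose)
    moreover have "blinfun_apply (Df t z) = (\<lambda>h. g' (t, z) (0, h))"
      by (simp add: Df_def bounded_linear_Blinfun_apply[OF bl] fun_eq_iff)
    ultimately show "(f t has_derivative blinfun_apply (Df t z)) (at z)"
      by simp
  qed
  then show ?thesis by (rule that)
qed

section \<open>Selection matrices and initial values in coordinates\<close>

lemma P_T_mult_component: "(P_T j *v v) $ r = v $ j r"
  by (simp add: P_T_def matrix_vector_mult_def if_distrib if_distribR cong: if_cong)

lemma transpose_P_0c_mult: "transpose P_0c *v h = initial_value 0 h"
  by (simp add: vec_eq_iff P_0c_def initial_value_def transpose_def matrix_vector_mult_def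
        if_distrib if_distribR cong: if_cong split: sum.split)

lemma transpose_adjoint_matrix_mult_component:
  "(transpose (adjoint_matrix p t) *v v) $ i = p i t \<bullet> v"
  by (simp add: adjoint_matrix_def transpose_def matrix_vector_mult_def inner_vec_def)

lemma inner_initial_value_zero:
  "v \<bullet> initial_value 0 h = (\<Sum>l\<in>UNIV. v $ Inr l * h $ l)"
  by (simp add: inner_vec_def initial_value_def sum.Plus flip: UNIV_Plus_UNIV)

lemma initial_value_diff: "initial_value y0 c - initial_value y0 d = initial_value 0 (c - d)"
  by (simp add: vec_eq_iff initial_value_def split: sum.split)

text \<open>The map is affine in \<open>c\<close>; its linear part is multiplication by
  \<open>transpose P_0c\<close>, hence bounded.\<close>

lemma initial_value_has_derivative:
  fixes y0 :: "real ^ 'm::finite" and c :: "real ^ 'k::finite"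
  shows "(initial_value y0 has_derivative initial_value 0) (at c)"
proof -
  have lin: "bounded_linear (initial_value 0)"
    unfolding transpose_P_0c_mult[symmetric, abs_def] by (rule matrix_vector_mul_bounded_linear)
  have "((\<lambda>c. initial_value y0 0 + initial_value 0 c) has_derivative (\<lambda>h. 0 + initial_value 0 h)) (at c)"
    by (intro has_derivative_add has_derivative_const bounded_linear_imp_has_derivative lin)
  moreover have "initial_value y0 0 + initial_value 0 c = initial_value y0 c" for c :: "real ^ 'k"
    using initial_value_diff[of y0 c 0] by (simp add: algebra_simps)
  ultimately show ?thesis by simp
qed

lemma jacobian_eqI:
  fixes A :: "real ^ 'n ^ 'm"
  assumes "(f has_derivative (\<lambda>h. A *v h)) (at x)"
  shows "jacobian f (at x) = A"
  by (simp add: jacobian_def flip: frechet_derivative_at[OF assms])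

section \<open>Derivative of the shooting function\<close>

text \<open>Since \<open>p i T\<close> is the i-th basis vector, the adjoint identity differentiates
  the i-th coordinate of the final state. The chain rule through \<open>initial_value y0\<close>,
  taken at \<open>i = j r\<close>, gives row \<open>r\<close> of the matrix.\<close>

lemma shooting_has_derivative:
  fixes f :: "real \<Rightarrow> real ^ ('m::finite + 'k::finite) \<Rightarrow> real ^ ('m + 'k)"
  assumes T: "0 \<le> T"
    and C2: "twice_continuously_differentiable_on (\<lambda>(t, z). f t z) ({0..T} \<times> UNIV)"
    and x: "is_ivp_solution f T (initial_value y0 c) x"
    and adj: "\<And>i. is_adjoint f T x (p i)"
    and pT: "\<And>i. p i T = axis i 1"
  shows "(shooting f T j y0 yT has_derivative
           (\<lambda>h. (P_T j ** transpose (adjoint_matrix p 0) ** transpose P_0c) *v h)) (at c)"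
proof -
  obtain Df where "continuously_differentiable_field f Df T"
    using twice_continuously_differentiable_imp_field[OF T C2] .
  then interpret continuously_differentiable_field f Df T .
  have component: "((\<lambda>a. ivp_value f T a T $ i) has_derivative (\<lambda>h. p i 0 \<bullet> h)) (at (initial_value y0 c))" for i
  proof -
    have "((\<lambda>a. p i T \<bullet> ivp_value f T a T) has_derivative (\<lambda>h. p i 0 \<bullet> h)) (at (initial_value y0 c))"
    proof (rule ivp_value_inner_adjoint_has_derivative[OF x])
      fix t assume t: "t \<in> {0..T}"
      let ?J = "jacobian (f t) (at (x t))"
      show "(p i has_vector_derivative - (transpose ?J *v p i t)) (at t within {0..T})"
        using adj t by (simp add: is_adjoint_def)
      fix v
      \<comment> \<open>Uniqueness of derivatives identifies the Jacobian matrix with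
        \<open>Df t (x t)\<close>; moving its transpose across the inner product then gives the
        required duality.\<close>
      have "(f t has_derivative (\<lambda>h. ?J *v h)) (at (x t))"
        using derivative[OF t] by (intro jacobian_works[THEN iffD1]) (auto simp: differentiable_def)
      from has_derivative_unique[OF this derivative[OF t]]
      have "?J *v v = Df t (x t) v" by (rule fun_cong)
      then show "(transpose ?J *v p i t) \<bullet> v = p i t \<bullet> Df t (x t) v"
        by (simp add: dot_lmul_matrix)
    qed
    then show ?thesis by (simp add: pT inner_axis')
  qed
  have "((\<lambda>c. shooting f T j y0 yT c \<bullet> axis r 1) has_derivative
      (\<lambda>h. ((P_T j ** transpose (adjoint_matrix p 0) ** transpose P_0c) *v h) \<bullet> axis r 1)) (at c)" for r
  proof -
    have "((\<lambda>c. ivp_value f T (initial_value y0 c) T $ j r) has_derivative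
        (\<lambda>h. p (j r) 0 \<bullet> initial_value 0 h)) (at c)"
      using has_derivative_compose[OF initial_value_has_derivative component] .
    then have "((\<lambda>c. ivp_value f T (initial_value y0 c) T $ j r - yT $ r) has_derivative
        (\<lambda>h. p (j r) 0 \<bullet> initial_value 0 h)) (at c)"
      by (auto intro!: derivative_eq_intros)
    then show ?thesis
      by (simp add: shooting_def inner_axis P_T_mult_component transpose_P_0c_mult
            transpose_adjoint_matrix_mult_component
            flip: matrix_vector_mul_assoc del: transpose_matrix_vector)
  qed
  then show ?thesis
    by (subst has_derivative_componentwise_within) (auto simp: Basis_vec_def)
qed

section \<open>Inverse matrices and the Newton step\<close>

text \<open>\<open>matrix_inv\<close> is a Hilbert choice; invertibility supplies the witness that
  gives the chosen matrix both properties.\<close>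

lemma invertible_matrix_inv:
  fixes A :: "'a::semiring_1 ^ 'n ^ 'm"
  assumes "invertible A"
  shows "A ** matrix_inv A = mat 1" and "matrix_inv A ** A = mat 1"
  using someI_ex[OF assms[unfolded invertible_def]] by (auto simp: matrix_inv_def)

lemma matrix_vector_mult_eq_iff:
  fixes A :: "'a::comm_ring_1 ^ 'n ^ 'n"
  assumes "invertible A"
  shows "A *v v = b \<longleftrightarrow> v = matrix_inv A *v b"
  using invertible_matrix_inv[OF assms] by (metis matrix_vector_mul_assoc matrix_vector_mul_lid)

theorem mainTheorem2:
  fixes f :: "real \<Rightarrow> real ^ ('m::{finite,linorder} + 'k::{finite,linorder}) \<Rightarrow> real ^ ('m + 'k)"
    and T :: real
    and y0 :: "real ^ 'm::{finite,linorder}"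
    and yT :: "real ^ 'k::{finite,linorder}"
    and j :: "'k \<Rightarrow> 'm + 'k"
    and ck :: "real ^ 'k::{finite,linorder}"
    and x :: "real \<Rightarrow> real ^ ('m + 'k)"
    and p :: "'m + 'k \<Rightarrow> real \<Rightarrow> real ^ ('m + 'k)"
  defines "F \<equiv> shooting f T j y0 yT"
  assumes "T > 0"
    and "twice_continuously_differentiable_on (\<lambda>(t, z). f t z) ({0..T} \<times> UNIV)"
    and "monotone (<) index_less j"
    and "is_ivp_solution f T (initial_value y0 ck) x"
    and "\<And>i. is_adjoint f T x (p i)"
    and "\<And>i. p i T = axis i 1"
    and "invertible (jacobian F (at ck))"
  shows
    "(\<forall>c r. (\<Sum>l\<in>UNIV. p (j r) 0 $ Inr l * (c $ l - ck $ l))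
         = ((P_T j ** transpose (adjoint_matrix p 0) ** transpose P_0c) *v (c - ck)) $ r) \<and>
     (\<forall>r. yT $ r - x T $ j r = (- F ck) $ r) \<and>
     (\<forall>c. (\<forall>r. (\<Sum>l\<in>UNIV. p (j r) 0 $ Inr l * (c $ l - ck $ l)) = yT $ r - x T $ j r)
         \<longleftrightarrow> (P_T j ** transpose (adjoint_matrix p 0) ** transpose P_0c) *v (c - ck) = - F ck) \<and>
     (\<forall>c. (\<forall>r. (\<Sum>l\<in>UNIV. p (j r) 0 $ Inr l * (c $ l - ck $ l)) = yT $ r - x T $ j r)
         \<longleftrightarrow> c = ck - matrix_inv (jacobian F (at ck)) *v F ck)"
proof -
  define M where "M = P_T j ** transpose (adjoint_matrix p 0) ** transpose P_0c"
  have T: "0 \<le> T" using \<open>T > 0\<close> by simp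
  have "(F has_derivative (\<lambda>h. M *v h)) (at ck)"
    unfolding F_def M_def using T assms(3,5-7) by (rule shooting_has_derivative)
  \<comment> \<open>This carries the invertibility assumed for the Jacobian over to the matrix of
    the linear system.\<close>
  then have J: "jacobian F (at ck) = M" by (rule jacobian_eqI)
  have sys: "(\<Sum>l\<in>UNIV. p (j r) 0 $ Inr l * (c $ l - ck $ l)) = (M *v (c - ck)) $ r" for c r
    by (simp add: M_def P_T_mult_component transpose_P_0c_mult inner_initial_value_zero
          transpose_adjoint_matrix_mult_component
          flip: matrix_vector_mul_assoc del: transpose_matrix_vector)
  \<comment> \<open>Uniqueness of solutions replaces the abstract final value inside
    \<open>F ck\<close> by the given \<open>x T\<close>.\<close>
  obtain Df where "continuously_differentiable_field f Df T"
    using twice_continuously_differentiable_imp_field[OF T assms(3)] .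
  then have "ivp_value f T (initial_value y0 ck) T = x T"
    using continuously_differentiable_field.ivp_value_eq assms(5) T by fastforce
  then have rhs: "yT $ r - x T $ j r = (- F ck) $ r" for r
    by (simp add: F_def shooting_def P_T_mult_component)
  have newton: "M *v (c - ck) = - F ck \<longleftrightarrow> c = ck - matrix_inv M *v F ck" for c
  proof -
    have "M *v (c - ck) = - F ck \<longleftrightarrow> c - ck = matrix_inv M *v (- F ck)"
      using assms(8) by (intro matrix_vector_mult_eq_iff) (simp add: J)
    also have "matrix_inv M *v (- F ck) = - (matrix_inv M *v F ck)"
      using matrix_vector_mult_diff_distrib[of "matrix_inv M" 0 "F ck"] by simp
    finally show ?thesis by (auto simp: algebra_simps)
  qed
  show ?thesis
    unfolding M_def[symmetric] J sys rhs newton[symmetric] by (auto simp: vec_eq_iff)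
qed

end
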